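(* For every finite tree $T$, the diameter of the eccentric graph $ecc(T)$ is at most $3$.
   Context: For a connected graph $G=(V,E)$, $d_G(u,v)$ is the minimum number of edges of a path from $u$ to $v$. The eccentricity of a vertex $u$ is $ecc(u)=\max_{v\in V} d_G(u,v)$, and the diameter of $G$ is the maximum eccentricity over all vertices. The eccentric graph $ecc(G)$ is the simple graph with vertex set $V$ in which two distinct vertices $u,v$ are adjacent if and only if $d_G(u,v)=ecc(u)$ or $d_G(u,v)=ecc(v)$ (distances and eccentricities taken in $G$). *)

theory Defs
  imports "Graph_Theory.Graph_Theory" "HOL-Library.Extended_Nat"
begin

text \<open>
  Finite simple graphs are the symmetric loop-free digraphs \<^locale>\<open>pair_graph\<close>: an edge between
  \<open>u\<close> and \<open>v\<close> is the pair of arcs \<open>(u, v)\<close>, \<open>(v, u)\<close>.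

  The library's \<^const>\<open>tree\<close> cannot be used for them: its \<^const>\<open>forest\<close> regards the walk
  \<open>u, v, u\<close> along a single undirected edge as a cycle. The cycles of a simple graph are the
  directed cycles with at least three arcs.
\<close>

definition undirected_tree :: "('a,'b) pre_digraph \<Rightarrow> bool" where
  "undirected_tree G \<longleftrightarrow>
     Digraph_Component.connected G \<and> \<not> (\<exists>p. pre_digraph.cycle G p \<and> 3 \<le> length p)"

text \<open>
  Distances take values in \<^typ>\<open>enat\<close>: the infimum is attained if there is a path from \<open>u\<close>
  to \<open>v\<close> and is \<open>\<infinity>\<close> otherwise. So a disconnected graph has infinite diameter, and a finite
  bound on the diameter of a nonempty graph entails connectedness.
\<close>

definition graph_dist :: "('a,'b) pre_digraph \<Rightarrow> 'a \<Rightarrow> 'a \<Rightarrow> enat" where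
  "graph_dist G u v = (INF p \<in> {p. pre_digraph.apath G u p v}. enat (length p))"

definition eccentricity :: "('a,'b) pre_digraph \<Rightarrow> 'a \<Rightarrow> enat" where
  "eccentricity G u = (SUP v \<in> verts G. graph_dist G u v)"

definition graph_diameter :: "('a,'b) pre_digraph \<Rightarrow> enat" where
  "graph_diameter G = (SUP u \<in> verts G. eccentricity G u)"

definition eccentric_graph :: "('a,'b) pre_digraph \<Rightarrow> 'a pair_pre_digraph" where
  "eccentric_graph G =
     \<lparr> pverts = verts G,
       parcs = {(u, v). u \<in> verts G \<and> v \<in> verts G \<and> u \<noteq> v \<and>
                  (graph_dist G u v = eccentricity G u \<or> graph_dist G u v = eccentricity G v)} \<rparr>"

lemma (in pair_graph) graph_dist_commute:
  "graph_dist (with_proj G) u v = graph_dist (with_proj G) v u"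
proof -
  have le: "graph_dist (with_proj G) x y \<le> graph_dist (with_proj G) y x" for x y
    unfolding graph_dist_def
  proof (rule INF_greatest)
    fix p assume "p \<in> {p. apath y p x}"
    then have p: "apath y p x" by simp
    then have "awalk y p x" by (simp add: apath_def)
    then have "awalk x (rev_path p) y" by (simp add: awalk_rev_path)
    moreover have "pawalk_verts x (rev_path p) = rev (pawalk_verts y p)"
      using \<open>awalk y p x\<close> by (simp add: awalk_verts_rev_path)
    ultimately have "apath x (rev_path p) y"
      using p by (simp add: apath_def)
    moreover have "length (rev_path p) = length p"
      by (induct p) auto
    ultimately show "(INF q \<in> {q. apath x q y}. enat (length q)) \<le> enat (length p)"
      by (metis (mono_tags, lifting) INF_lower mem_Collect_eq)
  qed
  show ?thesis by (rule antisym) (rule le)+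
qed

lemma (in pair_graph) pair_graph_eccentric_graph:
  "pair_graph (eccentric_graph (with_proj G))"
proof -
  let ?E = "eccentric_graph (with_proj G)"
  have "parcs ?E \<subseteq> pverts G \<times> pverts G"
    by (auto simp: eccentric_graph_def)
  then have "finite (parcs ?E)"
    by (rule finite_subset) (simp add: pair_finite_verts)
  then show ?thesis
    by unfold_locales
      (auto simp: eccentric_graph_def pair_finite_verts symmetric_def sym_def graph_dist_commute)
qed

end

theory Submission
  imports Defs
begin

text \<open>
  Let \<open>a\<close>, \<open>b\<close> be two vertices of the tree at maximum distance. Every vertex \<open>u\<close> has \<open>a\<close> or \<open>b\<close>
  among the vertices farthest from it, so in the eccentric graph \<open>u\<close> is equal or adjacent to \<open>a\<close>
  or \<open>b\<close>. Since \<open>a\<close> and \<open>b\<close> are farthest from each other, they are equal or adjacent as well, and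
  any two vertices are joined by a walk with at most three edges that passes through \<open>a\<close> or \<open>b\<close>.

  The fact about \<open>a\<close> and \<open>b\<close> is where the graph has to be a tree. Acyclicity enters only through
  its local effect on distances (\<open>closer_neighbour_unique\<close>): seen from any vertex \<open>v\<close>, a vertex
  \<open>x\<close> has at most one neighbour that is not farther away than \<open>x\<close> itself. Hence a geodesic that
  has once moved away from \<open>v\<close> keeps doing so (\<open>geodesic_away\<close>). Two consequences give the fact:

  \<^item> some vertex \<open>m\<close> on a geodesic from \<open>a\<close> to \<open>b\<close> lies between \<open>u\<close> and \<open>a\<close> and also between \<open>u\<close>
    and \<open>b\<close> (\<open>median\<close>);
  \<^item> for every vertex \<open>v\<close> this \<open>m\<close> lies between \<open>v\<close> and one of \<open>a\<close>, \<open>b\<close>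
    (\<open>between_or_between\<close>), say \<open>a\<close>. Then \<open>d v m + d m a = d v a \<le> d a b = d a m + d m b\<close>, so
    \<open>d v m \<le> d m b\<close> and \<open>d u v \<le> d u m + d m v \<le> d u m + d m b = d u b\<close>.
\<close>

section \<open>Metrics with at most one non-receding neighbour\<close>

text \<open>
  The axioms isolate what is used of distances in a tree. Asking \<open>closer_unique\<close> of all neighbours
  with \<open>d y v \<le> d x v\<close>, and not only of the strictly closer ones, also excludes edges between
  vertices at equal distance from \<open>v\<close>, as they occur in odd cycles.
\<close>

locale tree_metric =
  fixes V :: "'a set" and E :: "'a rel" and d :: "'a \<Rightarrow> 'a \<Rightarrow> nat"
  assumes edge_in: "(x, y) \<in> E \<Longrightarrow> x \<in> V \<and> y \<in> V"
    and edge_dist: "(x, y) \<in> E \<Longrightarrow> d x y \<le> 1"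
    and edge_commute: "(x, y) \<in> E \<Longrightarrow> (y, x) \<in> E"
    and dist_0_iff: "\<lbrakk>x \<in> V; y \<in> V\<rbrakk> \<Longrightarrow> d x y = 0 \<longleftrightarrow> x = y"
    and dist_commute: "d x y = d y x"
    and triangle: "\<lbrakk>x \<in> V; y \<in> V; z \<in> V\<rbrakk> \<Longrightarrow> d x z \<le> d x y + d y z"
    and closer_ex: "\<lbrakk>x \<in> V; v \<in> V; x \<noteq> v\<rbrakk> \<Longrightarrow> \<exists>y. (x, y) \<in> E \<and> d x v = Suc (d y v)"
    and closer_unique: "\<lbrakk>v \<in> V; (x, y) \<in> E; (x, z) \<in> E; d y v \<le> d x v; d z v \<le> d x v\<rbrakk> \<Longrightarrow> y = z"
begin

lemma edge_dist_le:
  assumes "(x, y) \<in> E" "v \<in> V"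
  shows "d y v \<le> Suc (d x v)"
  using edge_in[OF assms(1)] edge_dist[OF assms(1)] triangle[of y x v] assms(2) dist_commute[of x y]
  by auto

text \<open>
  The step from \<open>x\<close> to \<open>y\<close> leads away from \<open>v\<close>. So \<open>x\<close> is the one neighbour of \<open>y\<close> that is not
  farther from \<open>v\<close> than \<open>y\<close>, and the next step towards \<open>w\<close>, which does not return to \<open>x\<close>, leads
  away from \<open>v\<close> again.
\<close>

lemma geodesic_away:
  assumes "v \<in> V" "w \<in> V" "(x, y) \<in> E" "d y v = Suc (d x v)" "d x w = Suc (d y w)"
  shows "d v w = d v x + d x w"
  using assms(3-)
proof (induction "d y w" arbitrary: x y)
  case 0
  then have "y = w" using edge_in dist_0_iff assms(2) by metis
  then show ?case using 0 dist_commute by (metis One_nat_def add.commute plus_1_eq_Suc)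
next
  case (Suc n)
  have y: "y \<in> V" using edge_in Suc.prems(1) by blast
  have "y \<noteq> w" using Suc.hyps(2) dist_0_iff[OF y assms(2)] by simp
  then obtain y' where y': "(y, y') \<in> E" "d y w = Suc (d y' w)"
    using closer_ex[OF y assms(2)] by blast
  have "y' \<noteq> x" using y'(2) Suc.prems(3) by auto
  then have "\<not> d y' v \<le> d y v"
    using closer_unique[OF assms(1) y'(1) edge_commute[OF Suc.prems(1)]] Suc.prems(2) by auto
  then have "d y' v = Suc (d y v)" using edge_dist_le[OF y'(1) assms(1)] by simp
  moreover have "n = d y' w" using Suc.hyps(2) y'(2) by simp
  ultimately have "d v w = d v y + d y w" using Suc.hyps(1) y' by blast
  then show ?case using Suc.prems(2,3) dist_commute[of v] by simp
qed

lemma geodesic_away_step: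
  assumes "v \<in> V" "w \<in> V" "(x, y) \<in> E" "\<not> d y v \<le> d x v" "d x w = Suc (d y w)"
  shows "d v w = d v x + d x w"
proof -
  have "d y v = Suc (d x v)" using edge_dist_le[OF assms(3,1)] assms(4) by simp
  then show ?thesis using geodesic_away[OF assms(1-3) _ assms(5)] by blast
qed

text \<open>
  The first steps from \<open>m\<close> towards \<open>a\<close> and towards \<open>b\<close> go to different neighbours, of which at
  most one does not recede from \<open>v\<close>.
\<close>

lemma between_or_between:
  assumes "a \<in> V" "b \<in> V" "m \<in> V" "v \<in> V" and btw: "d a b = d a m + d m b"
  shows "d v a = d v m + d m a \<or> d v b = d v m + d m b"
proof (cases "m = a \<or> m = b")
  case True
  then show ?thesis using dist_0_iff assms by auto
next
  case False
  then obtain x y where x: "(m, x) \<in> E" "d m a = Suc (d x a)"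
    and y: "(m, y) \<in> E" "d m b = Suc (d y b)"
    using closer_ex assms by meson
  have "x \<noteq> y"
    using triangle[of a x b] edge_in[OF x(1)] assms x(2) y(2) dist_commute[of a] by auto
  then have "\<not> d x v \<le> d m v \<or> \<not> d y v \<le> d m v"
    using closer_unique[OF \<open>v \<in> V\<close> x(1) y(1)] by blast
  then show ?thesis using geodesic_away_step[OF \<open>v \<in> V\<close>] x y assms(1,2) by blast
qed

text \<open>
  The median is the vertex between \<open>a\<close> and \<open>b\<close> that is closest to \<open>u\<close>: a first step from it
  towards \<open>a\<close> or \<open>b\<close> stays between \<open>a\<close> and \<open>b\<close>, hence does not approach \<open>u\<close>. The neighbour
  towards \<open>u\<close> is the only one that does not recede from \<open>u\<close>, so this first step recedes.
\<close>

lemma median: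
  assumes "a \<in> V" "b \<in> V" "u \<in> V"
  obtains m where "m \<in> V" "d a b = d a m + d m b"
    "d u a = d u m + d m a" "d u b = d u m + d m b"
proof -
  have a: "a \<in> V \<and> d a b = d a a + d a b" using assms dist_0_iff by auto
  define m where "m = arg_min (\<lambda>m. d m u) (\<lambda>m. m \<in> V \<and> d a b = d a m + d m b)"
  have m: "m \<in> V" "d a b = d a m + d m b"
    using arg_min_natI[of "\<lambda>m. m \<in> V \<and> d a b = d a m + d m b", OF a] unfolding m_def by auto
  have min: "d m u \<le> d x u" if "x \<in> V" "d a b = d a x + d x b" for x
    using arg_min_nat_le[of "\<lambda>m. m \<in> V \<and> d a b = d a m + d m b" x "\<lambda>m. d m u"] that
    unfolding m_def by auto
  have reach: "d u e = d u m + d m e"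
    if e: "e \<in> V" "e' \<in> V" and btw: "d e e' = d e m + d m e'"
      and min: "\<And>x. \<lbrakk>x \<in> V; d e e' = d e x + d x e'\<rbrakk> \<Longrightarrow> d m u \<le> d x u" for e e'
  proof (cases "m = e \<or> m = u")
    case True
    then show ?thesis using dist_0_iff e assms by auto
  next
    case False
    then obtain x y where x: "(m, x) \<in> E" "d m e = Suc (d x e)"
      and y: "(m, y) \<in> E" "d m u = Suc (d y u)"
      using closer_ex m(1) assms(3) e(1) by meson
    have xV: "x \<in> V" using edge_in x(1) by blast
    have "d e e' = d e x + d x e'"
      using triangle[OF e(1) xV e(2)] edge_dist_le[OF x(1) e(2)] x(2) btw
        dist_commute[of e m] dist_commute[of e x] by simp
    then have le: "d m u \<le> d x u" using min xV by blast
    then have "x \<noteq> y" using y(2) by auto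
    then have "\<not> d x u \<le> d m u"
      using closer_unique[OF assms(3) x(1) y(1)] y(2) by auto
    then show ?thesis using geodesic_away_step[OF assms(3) e(1) x(1)] x(2) by blast
  qed
  have "d u a = d u m + d m a" using reach[OF assms(1,2) m(2)] min by blast
  moreover have "d u b = d u m + d m b"
    using reach[OF assms(2,1)] m min by (simp add: dist_commute add.commute)
  ultimately show thesis using that m by blast
qed

lemma diametral_pair_farthest:
  assumes "a \<in> V" "b \<in> V" and diam: "\<And>x y. \<lbrakk>x \<in> V; y \<in> V\<rbrakk> \<Longrightarrow> d x y \<le> d a b"
    and "u \<in> V" "v \<in> V"
  shows "d u v \<le> max (d u a) (d u b)"
proof -
  obtain m where m: "m \<in> V" "d a b = d a m + d m b"
    "d u a = d u m + d m a" "d u b = d u m + d m b"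
    using median assms by metis
  have "d v m \<le> max (d m a) (d m b)"
    using between_or_between[OF assms(1,2) m(1) \<open>v \<in> V\<close> m(2)]
      diam[OF \<open>v \<in> V\<close> assms(1)] diam[OF \<open>v \<in> V\<close> assms(2)] m(2) dist_commute[of a m]
    by auto
  moreover have "d u v \<le> d u m + d v m"
    using triangle[OF \<open>u \<in> V\<close> m(1) \<open>v \<in> V\<close>] dist_commute[of v m] by simp
  ultimately show ?thesis using m(3,4) by auto
qed

end

section \<open>Distances in digraphs\<close>

context wf_digraph
begin

lemma graph_dist_attained:
  assumes "graph_dist G u v \<noteq> \<infinity>"
  obtains p where "apath u p v" "graph_dist G u v = enat (length p)"
proof -
  let ?S = "(\<lambda>p. enat (length p)) ` {p. apath u p v}"
  have "?S \<noteq> {}"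
    using assms unfolding graph_dist_def by (metis Inf_empty top_enat_def)
  then have "Inf ?S \<in> ?S" by (meson ex_in_conv wellorder_InfI)
  then show thesis using that unfolding graph_dist_def by auto
qed

text \<open>Cutting cycles out of a walk turns it into a path and only makes it shorter.\<close>

lemma length_awalk_to_apath:
  assumes "awalk u p v"
  shows "length (awalk_to_apath p) \<le> length p"
  using assms
proof (induct rule: awalk_to_apath_induct)
  case (path p)
  then have "awalk_to_apath p = p" by (auto simp: awalk_to_apath.simps)
  then show ?case by simp
next
  case (decomp p q r s)
  then have "p = q @ r @ s" by (auto elim: awalk_cyc_decompE)
  then show ?case using decomp step_awalk_to_apath[of u p v q r s] by simp
qed

lemma graph_dist_le_awalk:
  assumes "awalk u p v"
  shows "graph_dist G u v \<le> enat (length p)"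
proof -
  have "graph_dist G u v \<le> enat (length (awalk_to_apath p))"
    unfolding graph_dist_def using apath_awalk_to_apath[OF assms] by (auto intro: INF_lower)
  then show ?thesis
    using length_awalk_to_apath[OF assms] by (meson enat_ord_simps(1) order_trans)
qed

lemma graph_dist_triangle: "graph_dist G u w \<le> graph_dist G u v + graph_dist G v w"
proof (cases "graph_dist G u v = \<infinity> \<or> graph_dist G v w = \<infinity>")
  case False
  obtain p where p: "apath u p v" "graph_dist G u v = enat (length p)"
    using False graph_dist_attained by blast
  obtain q where q: "apath v q w" "graph_dist G v w = enat (length q)"
    using False graph_dist_attained by blast
  have "awalk u (p @ q) w" using p q by (auto simp: apath_def)
  from graph_dist_le_awalk[OF this] show ?thesis using p q by simp
qed auto

lemma graph_dist_eq_0_iff: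
  assumes "u \<in> verts G"
  shows "graph_dist G u v = 0 \<longleftrightarrow> u = v"
proof
  assume 0: "graph_dist G u v = 0"
  then obtain p where p: "apath u p v" "graph_dist G u v = enat (length p)"
    using graph_dist_attained[of u v] by auto
  then have "p = []" using 0 by (simp add: zero_enat_def)
  then show "u = v" using p by (simp add: apath_Nil_iff)
next
  assume "u = v"
  then show "graph_dist G u v = 0"
    using graph_dist_le_awalk[of u "[]" v] assms by (simp add: awalk_Nil_iff zero_enat_def[symmetric])
qed

lemma graph_dist_arc:
  assumes "e \<in> arcs G"
  shows "graph_dist G (tail G e) (head G e) \<le> 1"
  using graph_dist_le_awalk[OF arc_implies_awalk[OF assms]] by (simp add: one_enat_def)

text \<open>
  A geodesic from \<open>y\<close> to \<open>v\<close> through \<open>x \<noteq> y\<close> has a proper final part from \<open>x\<close> to \<open>v\<close>, which would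
  make \<open>x\<close> strictly closer to \<open>v\<close>.
\<close>

lemma geodesic_avoids:
  assumes p: "awalk y p v" "graph_dist G y v = enat (length p)"
    and le: "graph_dist G y v \<le> graph_dist G x v" and "x \<noteq> y"
  shows "x \<notin> set (awalk_verts y p)"
proof
  assume "x \<in> set (awalk_verts y p)"
  then obtain q r where qr: "p = q @ r" "awalk y q x" "awalk x r v"
    using awalk_decomp[OF p(1)] by blast
  have "q \<noteq> []" using qr(2) \<open>x \<noteq> y\<close> by (auto simp: awalk_Nil_iff)
  then have "length r < length p" using qr(1) by simp
  moreover have "enat (length p) \<le> enat (length r)"
    using le p(2) graph_dist_le_awalk[OF qr(3)] by (metis order_trans)
  ultimately show False by simp
qed

end

section \<open>Distances in trees\<close>

context pair_graph
begin

text \<open>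
  Otherwise the geodesics from \<open>y\<close> and \<open>z\<close> to \<open>v\<close>, which avoid \<open>x\<close>, contain a path from \<open>y\<close> to
  \<open>z\<close>, and \<open>x\<close> closes this path to a cycle with at least three arcs.
\<close>

lemma closer_neighbour_unique:
  assumes tree: "undirected_tree (with_proj G)"
    and xy: "(x, y) \<in> parcs G" and xz: "(x, z) \<in> parcs G"
    and fin: "graph_dist (with_proj G) x v \<noteq> \<infinity>"
    and le_y: "graph_dist (with_proj G) y v \<le> graph_dist (with_proj G) x v"
    and le_z: "graph_dist (with_proj G) z v \<le> graph_dist (with_proj G) x v"
  shows "y = z"
proof (rule ccontr)
  assume "y \<noteq> z"
  have "x \<noteq> y" "x \<noteq> z" using pair_no_loops xy xz by fastforce+
  have "graph_dist (with_proj G) y v \<noteq> \<infinity>" "graph_dist (with_proj G) z v \<noteq> \<infinity>"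
    using fin le_y le_z by (metis enat_ord_simps(5))+
  then obtain p q where p: "apath y p v" "graph_dist (with_proj G) y v = enat (length p)"
    and q: "apath z q v" "graph_dist (with_proj G) z v = enat (length q)"
    using graph_dist_attained by metis
  have pw: "awalk y p v" and qw: "awalk z q v" using p q by (auto simp: apath_def)
  have x_p: "x \<notin> set (pawalk_verts y p)" using geodesic_avoids[OF pw p(2) le_y \<open>x \<noteq> y\<close>] .
  have x_q: "x \<notin> set (pawalk_verts z q)" using geodesic_avoids[OF qw q(2) le_z \<open>x \<noteq> z\<close>] .
  have rw: "awalk v (rev_path q) z" using qw by (simp add: awalk_rev_path)
  have x_rq: "x \<notin> set (pawalk_verts v (rev_path q))"
    using x_q awalk_verts_rev_path[OF qw] by simp
  define w where "w = p @ rev_path q"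
  have ww: "awalk y w z" unfolding w_def using pw rw by (auto intro: awalk_appendI)
  have x_w: "x \<notin> set (pawalk_verts y w)"
    unfolding w_def using x_p x_rq set_awalk_verts_append[OF pw rw] by simp
  define r where "r = awalk_to_apath w"
  have r: "apath y r z" unfolding r_def using apath_awalk_to_apath[OF ww] .
  have rww: "awalk y r z" using r by (simp add: apath_def)
  have "set r \<subseteq> set w" unfolding r_def using awalk_to_apath_subset[OF ww] .
  then have x_r: "x \<notin> set (pawalk_verts y r)"
    using x_w set_awalk_verts[OF ww] set_awalk_verts[OF rww] by auto
  have "r \<noteq> []" using rww \<open>y \<noteq> z\<close> by (auto simp: awalk_Nil_iff)
  have zx: "(z, x) \<in> parcs G" using arcs_symmetric xz by blast
  have x: "x \<in> pverts G" using in_arcsD1 xy by blast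
  define c where "c = (x, y) # r @ [(z, x)]"
  have z_x: "awalk z [(z, x)] x" using zx x in_arcsD1 by (simp add: awalk_simps)
  have cw: "awalk x c x"
    unfolding c_def using xy x rww z_x by (simp add: awalk_Cons_iff)
  have "pawalk_verts y (r @ [(z, x)]) = pawalk_verts y r @ [x]"
    using awalk_verts_append2[of y r "[(z, x)]" x] awalk_appendI[OF rww z_x] rww z_x by auto
  then have "distinct (tl (pawalk_verts x c))"
    unfolding c_def using r x_r by (auto simp: apath_def)
  moreover have "3 \<le> length c" using \<open>r \<noteq> []\<close> unfolding c_def by (cases r) auto
  ultimately show False
    using tree cw unfolding undirected_tree_def cycle_def by fastforce
qed

lemma graph_dist_finite:
  assumes "Digraph_Component.connected (with_proj G)" "u \<in> pverts G" "v \<in> pverts G"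
  shows "graph_dist (with_proj G) u v \<noteq> \<infinity>"
proof -
  have "strongly_connected (with_proj G)"
    using symmetric_connected_imp_strongly_connected[OF sym_arcs assms(1)] .
  then have "u \<rightarrow>\<^sup>*\<^bsub>with_proj G\<^esub> v"
    using assms(2,3) by (simp add: strongly_connected_def)
  then obtain p where "awalk u p v" unfolding reachable_awalk ..
  from graph_dist_le_awalk[OF this] show ?thesis by (cases "graph_dist (with_proj G) u v") simp_all
qed

text \<open>
  Distances are finite in a connected graph, so the conversion to natural numbers loses
  nothing on vertices.
\<close>

lemma tree_metric_graph_dist:
  assumes tree: "undirected_tree (with_proj G)"
  shows "tree_metric (pverts G) (parcs G) (\<lambda>u v. the_enat (graph_dist (with_proj G) u v))"
    (is "tree_metric _ _ ?d")
proof -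
  have conn: "Digraph_Component.connected (with_proj G)"
    using tree by (simp add: undirected_tree_def)
  have d: "graph_dist (with_proj G) u v = enat (?d u v)" if "u \<in> pverts G" "v \<in> pverts G" for u v
    using graph_dist_finite[OF conn that] by auto
  have arc: "graph_dist (with_proj G) x y \<le> 1" if "(x, y) \<in> parcs G" for x y
    using graph_dist_arc[of "(x, y)"] that by simp
  show ?thesis
  proof
    fix x y assume "(x, y) \<in> parcs G"
    then show "x \<in> pverts G \<and> y \<in> pverts G" using wellformed' by blast
    then show "?d x y \<le> 1" using arc \<open>(x, y) \<in> parcs G\<close> d[of x y]
      by (metis enat_ord_simps(1) one_enat_def)
    show "(y, x) \<in> parcs G" using arcs_symmetric \<open>(x, y) \<in> parcs G\<close> by blast
  next
    fix x y assume "x \<in> pverts G" "y \<in> pverts G"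
    then show "?d x y = 0 \<longleftrightarrow> x = y"
      using graph_dist_eq_0_iff[of x y] d[of x y] by (metis enat_0_iff(1))
  next
    fix x y show "?d x y = ?d y x" by (simp add: graph_dist_commute)
  next
    fix x y z assume "x \<in> pverts G" "y \<in> pverts G" "z \<in> pverts G"
    then show "?d x z \<le> ?d x y + ?d y z"
      using graph_dist_triangle[of x z y] d by (metis enat_ord_simps(1) plus_enat_simps(1))
  next
    fix x v assume xv: "x \<in> pverts G" "v \<in> pverts G" "x \<noteq> v"
    obtain p where p: "apath x p v" "graph_dist (with_proj G) x v = enat (length p)"
      using graph_dist_attained[OF graph_dist_finite[OF conn xv(1,2)]] by blast
    then have pw: "awalk x p v" by (simp add: apath_def)
    with xv(3) obtain y q where q: "p = (x, y) # q" "(x, y) \<in> parcs G" "awalk y q v"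
      by (cases p) (auto simp: awalk_simps)
    have y: "y \<in> pverts G" using in_arcsD2 q(2) by blast
    have "enat (?d y v) \<le> enat (length q)"
      using graph_dist_le_awalk[OF q(3)] d[OF y xv(2)] by simp
    moreover have "enat (?d x v) \<le> 1 + enat (?d y v)"
      using graph_dist_triangle[of x v y] arc[OF q(2)] d[OF xv(1,2)] d[OF y xv(2)]
      by (metis add_right_mono order_trans)
    moreover have "?d x v = Suc (length q)" using p(2) q(1) by simp
    ultimately have "?d x v = Suc (?d y v)" by (simp add: one_enat_def)
    then show "\<exists>y. (x, y) \<in> parcs G \<and> ?d x v = Suc (?d y v)" using q(2) by blast
  next
    fix v x y z
    assume v: "v \<in> pverts G" and xy: "(x, y) \<in> parcs G" and xz: "(x, z) \<in> parcs G"
      and le: "?d y v \<le> ?d x v" "?d z v \<le> ?d x v"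
    have V: "x \<in> pverts G" "y \<in> pverts G" "z \<in> pverts G" using wellformed' xy xz by blast+
    show "y = z"
      using closer_neighbour_unique[OF tree xy xz graph_dist_finite[OF conn V(1) v]] le
        d[OF V(1) v] d[OF V(2) v] d[OF V(3) v] by (metis enat_ord_simps(1))
  qed
qed

end

section \<open>The eccentric graph\<close>

text \<open>
  The bound \<open>1\<close> on the distance in the eccentric graph covers the degenerate case \<open>u = w\<close> of a
  tree with a single vertex, where \<open>u\<close> is farthest from itself but not adjacent to itself.
\<close>

lemma (in pair_graph) eccentric_dist_farthest:
  assumes "u \<in> pverts G" "w \<in> pverts G"
    and far: "\<And>v. v \<in> pverts G \<Longrightarrow> graph_dist (with_proj G) u v \<le> graph_dist (with_proj G) u w"
  shows "graph_dist (with_proj (eccentric_graph (with_proj G))) u w \<le> 1"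
proof -
  interpret E: pair_graph "eccentric_graph (with_proj G)" by (rule pair_graph_eccentric_graph)
  show ?thesis
  proof (cases "u = w")
    case True
    then show ?thesis using E.graph_dist_eq_0_iff[of u w] assms by (simp add: eccentric_graph_def)
  next
    case False
    have "graph_dist (with_proj G) u w = eccentricity (with_proj G) u"
      unfolding eccentricity_def using assms by (intro antisym SUP_upper SUP_least) auto
    then have "(u, w) \<in> parcs (eccentric_graph (with_proj G))"
      using False assms by (simp add: eccentric_graph_def)
    then show ?thesis using E.graph_dist_arc[of "(u, w)"] by simp
  qed
qed

theorem theorem2p9:
  fixes T :: "'a pair_pre_digraph"
  assumes "pair_graph T"
    and "undirected_tree (with_proj T)"
  shows "graph_diameter (with_proj (eccentric_graph (with_proj T))) \<le> 3"
proof -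
  interpret T: pair_graph T by fact
  interpret E: pair_graph "eccentric_graph (with_proj T)" by (rule T.pair_graph_eccentric_graph)
  let ?V = "pverts T"
  let ?dT = "graph_dist (with_proj T)"
  let ?dE = "graph_dist (with_proj (eccentric_graph (with_proj T)))"
  define d where "d = (\<lambda>u v. the_enat (?dT u v))"
  interpret M: tree_metric ?V "parcs T" d
    unfolding d_def by (rule T.tree_metric_graph_dist) fact
  have dT: "?dT u v = enat (d u v)" if "u \<in> ?V" "v \<in> ?V" for u v
    using T.graph_dist_finite[OF _ that] assms(2) unfolding d_def undirected_tree_def by auto
  have near: "?dE u w \<le> 1" if "u \<in> ?V" "w \<in> ?V" "\<And>v. v \<in> ?V \<Longrightarrow> d u v \<le> d u w" for u w
    using that by (intro T.eccentric_dist_farthest) (auto simp: dT)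
  have "?dE u v \<le> 3" if uv: "u \<in> ?V" "v \<in> ?V" for u v
  proof -
    let ?D = "(\<lambda>(x, y). d x y) ` (?V \<times> ?V)"
    have D: "finite ?D" "?D \<noteq> {}"
      using T.pair_finite_verts uv by auto
    obtain e where e: "e \<in> ?V \<times> ?V" "Max ?D = (\<lambda>(x, y). d x y) e"
      using Max_in[OF D] by (rule imageE)
    obtain a b where "e = (a, b)" by fastforce
    with e have ab: "a \<in> ?V" "b \<in> ?V" "Max ?D = d a b" by simp_all
    have diam: "d x y \<le> d a b" if "x \<in> ?V" "y \<in> ?V" for x y
    proof -
      have "d x y \<in> ?D" using that by force
      then show ?thesis using Max_ge[OF D(1)] ab(3) by metis
    qed
    have end_near: "?dE w a \<le> 1 \<or> ?dE w b \<le> 1" if w: "w \<in> ?V" for w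
    proof (cases "d w a \<le> d w b")
      case True
      then show ?thesis
        using near[OF w ab(2)] M.diametral_pair_farthest[OF ab(1,2) diam w] by fastforce
    next
      case False
      then show ?thesis
        using near[OF w ab(1)] M.diametral_pair_farthest[OF ab(1,2) diam w] by fastforce
    qed
    have ends: "?dE s t \<le> 1" if "s \<in> {a, b}" "t \<in> {a, b}" for s t
    proof -
      have "?dE a b \<le> 1" using near[OF ab(1,2)] diam ab by blast
      moreover have "?dE x x = 0" if "x \<in> ?V" for x
        using E.graph_dist_eq_0_iff[of x x] that by (simp add: eccentric_graph_def)
      ultimately show ?thesis using that ab E.graph_dist_commute[of a b] by auto
    qed
    obtain s t where s: "s \<in> {a, b}" "?dE u s \<le> 1" and t: "t \<in> {a, b}" "?dE v t \<le> 1"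
      using end_near uv by blast
    have "?dE u v \<le> ?dE u s + (?dE s t + ?dE t v)"
      using E.graph_dist_triangle[of u v s] E.graph_dist_triangle[of s v t]
      by (meson add_left_mono order_trans)
    also have "\<dots> \<le> 1 + (1 + 1)"
      using s t ends[OF s(1) t(1)] E.graph_dist_commute[of t v] by (intro add_mono) auto
    finally show ?thesis by simp
  qed
  then show ?thesis
    unfolding graph_diameter_def eccentricity_def
    by (intro SUP_least) (auto simp: eccentric_graph_def)
qed

end
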